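(* Let $a>b$, $0<k<1$, and let $\delta,c_1,c_2\in\mathbb R$ with $\operatorname{cn}(\frac\delta2,k)>0$. For $(n_1,n_2)\in(\frac12\mathbb Z)^2$ put $$x=\frac{f_1(n_1)f_2(n_2)}{\sqrt{a-b}},\qquad y=\frac{g_1(n_1)g_2(n_2)}{\sqrt{a-b}},$$ where $$f_1(n_1)=\hat\alpha_1\operatorname{sn}(\delta n_1+c_1,k),\quad g_1(n_1)=\hat\beta_1\operatorname{dn}(\delta n_1+c_1,k),\quad f_2(n_2)=\hat\alpha_2\frac1{\operatorname{sn}(\delta n_2+c_2,k)},\quad g_2(n_2)=\hat\beta_2\frac{\operatorname{cn}(\delta n_2+c_2,k)}{\operatorname{sn}(\delta n_2+c_2,k)},$$ $$\hat\alpha_2=\frac1k\hat\alpha_1=\sqrt{(a-b)\frac{\operatorname{cn}(\frac\delta2,k)}{\operatorname{dn}(\frac\delta2,k)}},\qquad\hat\beta_2=\hat\beta_1=\sqrt{\frac{a-b}{\operatorname{dn}(\frac\delta2,k)}}.$$ The points $(x,y)$ with $n_1+n_2=\xi=\mathrm{const}$ lie on straight lines. The same is true for points $(x,y)$ with $n_2-n_1=\eta=\mathrm{const}$. Moreover, all these lines are tangent to the hyperbola $$\hat{\mathcal H}_0:\quad\frac{x^2}{\hat a_0}-\frac{y^2}{\hat c_0}=1,\qquad\hat a_0=(a-b)k^2\frac{\operatorname{cn}^2(\frac\delta2,k)}{\operatorname{dn}^2(\frac\delta2,k)},\quad\hat c_0=(a-b)(1-k^2)\frac1{\operatorname{dn}^2(\frac\delta2,k)}.$$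 This hyperbola belongs to the confocal family $\dfrac{x^2}{a+\lambda}+\dfrac{y^2}{b+\lambda}=1$, since $\hat a_0+\hat c_0=a-b$.
   Context: $\operatorname{sn},\operatorname{cn},\operatorname{dn}$ are the Jacobi elliptic functions with modulus $k$; points $(x,y)$ are considered where the expressions are defined, i.e. $\operatorname{sn}(\delta n_2+c_2,k)\ne0$; $\lambda\in\mathbb R$ is the parameter of the confocal family. *)

theory Defs
  imports "HOL-Analysis.Analysis"
begin

section \<open>Jacobi elliptic functions of a real argument\<close>

text \<open>
  The second argument \<open>k\<close> is the modulus (not the parameter \<open>m = k\<^sup>2\<close>).
  The integral is oriented, so \<open>ell_F\<close> is odd in its first argument.
\<close>

definition ell_F :: "real \<Rightarrow> real \<Rightarrow> real" where
  "ell_F \<phi> k = (LBINT \<theta>=0..\<phi>. 1 / sqrt (1 - k\<^sup>2 * (sin \<theta>)\<^sup>2))"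

definition jacobi_am :: "real \<Rightarrow> real \<Rightarrow> real" where
  "jacobi_am u k = (THE \<phi>. ell_F \<phi> k = u)"

definition jacobi_sn :: "real \<Rightarrow> real \<Rightarrow> real" where
  "jacobi_sn u k = sin (jacobi_am u k)"

definition jacobi_cn :: "real \<Rightarrow> real \<Rightarrow> real" where
  "jacobi_cn u k = cos (jacobi_am u k)"

definition jacobi_dn :: "real \<Rightarrow> real \<Rightarrow> real" where
  "jacobi_dn u k = sqrt (1 - k\<^sup>2 * (jacobi_sn u k)\<^sup>2)"

lemma modulus_bound:
  fixes k :: real
  assumes "0 < k" "k < 1"
  shows "0 < 1 - k\<^sup>2 * (sin \<theta>)\<^sup>2" "1 - k\<^sup>2 * (sin \<theta>)\<^sup>2 \<le> 1"
proof -
  have "k\<^sup>2 < 1" using assms by (simp add: power_less_one_iff)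
  moreover have "k\<^sup>2 * (sin \<theta>)\<^sup>2 \<le> k\<^sup>2 * 1"
    by (intro mult_left_mono) (auto simp: abs_square_le_1)
  ultimately show "0 < 1 - k\<^sup>2 * (sin \<theta>)\<^sup>2" by linarith
  show "1 - k\<^sup>2 * (sin \<theta>)\<^sup>2 \<le> 1" by simp
qed

lemma ell_F_has_real_derivative:
  assumes k: "0 < k" "k < 1"
  shows "((\<lambda>\<phi>. ell_F \<phi> k) has_real_derivative 1 / sqrt (1 - k\<^sup>2 * (sin \<phi>)\<^sup>2)) (at \<phi>)"
proof -
  let ?f = "\<lambda>\<theta>::real. 1 / sqrt (1 - k\<^sup>2 * (sin \<theta>)\<^sup>2)"
  define a where "a = - \<bar>\<phi>\<bar> - 1"
  define b where "b = \<bar>\<phi>\<bar> + 1"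
  have ab: "a \<le> 0" "0 \<le> b" "a < \<phi>" "\<phi> < b" by (auto simp: a_def b_def)
  have "continuous_on {a..b} ?f"
    using modulus_bound[OF k] by (intro continuous_intros) (auto simp: less_le)
  from interval_integral_FTC2[OF ab(1,2) this, of \<phi>] ab
  have "((\<lambda>u. LBINT y=ereal 0..ereal u. ?f y) has_vector_derivative ?f \<phi>) (at \<phi> within {a..b})"
    by simp
  then have "((\<lambda>u. LBINT y=ereal 0..ereal u. ?f y) has_vector_derivative ?f \<phi>) (at \<phi>)"
    using at_within_Icc_at[OF ab(3,4)] by simp
  then show ?thesis
    by (simp add: ell_F_def has_real_derivative_iff_has_vector_derivative zero_ereal_def)
qed

lemma ell_F_0: "ell_F 0 k = 0"
  by (simp add: ell_F_def zero_ereal_def)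

text \<open>\<open>ell_F\<close> is a bijection of the real line, so \<open>jacobi_am\<close> is well defined.\<close>

lemma ell_F_ex1:
  assumes k: "0 < k" "k < 1"
  shows "\<exists>!\<phi>. ell_F \<phi> k = u"
proof -
  let ?f = "\<lambda>\<theta>::real. 1 / sqrt (1 - k\<^sup>2 * (sin \<theta>)\<^sup>2)"
  have f1: "1 \<le> ?f \<theta>" for \<theta>
    using modulus_bound[OF k, of \<theta>] by simp
  have growth: "y - x \<le> ell_F y k - ell_F x k" if "x \<le> y" for x y
  proof -
    have "ell_F x k - x \<le> ell_F y k - y"
    proof (rule DERIV_nonneg_imp_nondecreasing[OF that])
      fix t
      have "((\<lambda>\<phi>. ell_F \<phi> k - \<phi>) has_real_derivative ?f t - 1) (at t)"
        by (intro derivative_intros ell_F_has_real_derivative k)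
      then show "\<exists>d. ((\<lambda>\<phi>. ell_F \<phi> k - \<phi>) has_real_derivative d) (at t) \<and> 0 \<le> d"
        using f1[of t] by (intro exI[of _ "?f t - 1"]) auto
    qed
    then show ?thesis by simp
  qed
  have cont: "isCont (\<lambda>\<phi>. ell_F \<phi> k) x" for x
    using ell_F_has_real_derivative[OF k] DERIV_isCont by blast
  have "\<exists>\<phi>\<ge>-\<bar>u\<bar>. \<phi> \<le> \<bar>u\<bar> \<and> ell_F \<phi> k = u"
    using growth[of 0 "\<bar>u\<bar>"] growth[of "-\<bar>u\<bar>" 0] cont
    by (intro IVT) (auto simp: ell_F_0)
  moreover have "x = y" if "ell_F x k = u" "ell_F y k = u" for x y
    using growth[of x y] growth[of y x] that by linarith
  ultimately show ?thesis by blast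
qed

lemma ell_F_jacobi_am:
  assumes "0 < k" "k < 1"
  shows "ell_F (jacobi_am u k) k = u"
  unfolding jacobi_am_def by (rule theI'[OF ell_F_ex1[OF assms]])


section \<open>Half-integers\<close>

definition half_ints :: "real set" where
  "half_ints = {of_int m / 2 | m :: int. True}"


section \<open>Lines, hyperbolas and the confocal family\<close>

definition straight_line :: "(real \<times> real) set \<Rightarrow> bool" where
  "straight_line L \<longleftrightarrow> affine L \<and> aff_dim L = 1"

definition hyperbola :: "real \<Rightarrow> real \<Rightarrow> (real \<times> real) set" where
  "hyperbola A C = {(x, y). x\<^sup>2 / A - y\<^sup>2 / C = 1}"

definition confocal_family :: "real \<Rightarrow> real \<Rightarrow> (real \<times> real) set set" where
  "confocal_family a b =
     {Q. \<exists>l::real. a + l \<noteq> 0 \<and> b + l \<noteq> 0 \<and>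
           Q = {(x, y). x\<^sup>2 / (a + l) + y\<^sup>2 / (b + l) = 1}}"

text \<open>
  Tangency is understood in the projective plane: the affine point \<open>(x, y)\<close> has homogeneous
  coordinates \<open>(x, y, 1)\<close>, and the tangent line at a point \<open>P\<close> of the projective closure of the
  hyperbola is the kernel of the derivative at \<open>P\<close> of the homogenized equation.
  For \<open>P\<close> at infinity the tangent line is an asymptote; see
  \<open>tangent_to_hyperbola_iff\<close> below.
\<close>

definition hyperbola_form :: "real \<Rightarrow> real \<Rightarrow> real \<times> real \<times> real \<Rightarrow> real" where
  "hyperbola_form A C = (\<lambda>(X, Y, Z). X\<^sup>2 / A - Y\<^sup>2 / C - Z\<^sup>2)"

definition tangent_to_hyperbola :: "real \<Rightarrow> real \<Rightarrow> (real \<times> real) set \<Rightarrow> bool" where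
  "tangent_to_hyperbola A C L \<longleftrightarrow>
     (\<exists>P D. P \<noteq> 0 \<and> hyperbola_form A C P = 0 \<and>
        (hyperbola_form A C has_derivative D) (at P) \<and>
        L = {(x, y). D (x, y, 1) = 0})"

lemma hyperbola_form_has_derivative:
  "(hyperbola_form A C has_derivative
     (\<lambda>(x, y, z). 2 * (X * x / A - Y * y / C - Z * z))) (at (X, Y, Z))"
proof -
  have "((\<lambda>p. (fst p)\<^sup>2 / A - (fst (snd p))\<^sup>2 / C - (snd (snd p))\<^sup>2) has_derivative
     (\<lambda>(x, y, z). 2 * (X * x / A - Y * y / C - Z * z))) (at (X, Y, Z))"
    unfolding divide_inverse
    by (auto intro!: derivative_eq_intros simp: fun_eq_iff algebra_simps)
  then show ?thesis
    by (simp add: hyperbola_form_def case_prod_unfold)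
qed

lemma tangent_to_hyperbola_iff:
  assumes "0 < A" "0 < C"
  shows "tangent_to_hyperbola A C L \<longleftrightarrow>
    (\<exists>x\<^sub>0 y\<^sub>0. (x\<^sub>0, y\<^sub>0) \<in> hyperbola A C \<and> L = {(x, y). x\<^sub>0 * x / A - y\<^sub>0 * y / C = 1}) \<or>
    L = {(x, y). y = sqrt (C / A) * x} \<or> L = {(x, y). y = - sqrt (C / A) * x}"
    (is "_ \<longleftrightarrow> ?affine \<or> ?asymptote")
proof -
  have 1: "tangent_to_hyperbola A C L \<longleftrightarrow>
    (\<exists>X Y Z. (X, Y, Z) \<noteq> 0 \<and> X\<^sup>2 / A - Y\<^sup>2 / C = Z\<^sup>2 \<and>
       L = {(x, y). X * x / A - Y * y / C = Z})" (is "_ \<longleftrightarrow> ?hom")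
  proof
    assume "tangent_to_hyperbola A C L"
    then obtain X Y Z D where *: "(X, Y, Z) \<noteq> 0" "hyperbola_form A C (X, Y, Z) = 0"
      "(hyperbola_form A C has_derivative D) (at (X, Y, Z))" "L = {(x, y). D (x, y, 1) = 0}"
      unfolding tangent_to_hyperbola_def by (metis prod_cases3)
    have "D = (\<lambda>(x, y, z). 2 * (X * x / A - Y * y / C - Z * z))"
      using has_derivative_unique[OF *(3) hyperbola_form_has_derivative] .
    then show ?hom using * by (intro exI[of _ X] exI[of _ Y] exI[of _ Z])
        (auto simp: hyperbola_form_def)
  next
    assume ?hom
    then obtain X Y Z where *: "(X, Y, Z) \<noteq> 0" "X\<^sup>2 / A - Y\<^sup>2 / C = Z\<^sup>2"
       "L = {(x, y). X * x / A - Y * y / C = Z}" by blast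
    show "tangent_to_hyperbola A C L"
      unfolding tangent_to_hyperbola_def
      by (rule exI[of _ "(X, Y, Z)"], rule exI, intro conjI, rule *(1), use * in
          \<open>simp add: hyperbola_form_def\<close>, rule hyperbola_form_has_derivative)
        (use * in auto)
  qed
  define r where "r = sqrt (C / A)"
  have r: "r > 0" "C = r\<^sup>2 * A" using assms by (auto simp: r_def)
  have "?hom \<longleftrightarrow> ?affine \<or> ?asymptote"
  proof
    assume ?hom
    then obtain X Y Z where *: "(X, Y, Z) \<noteq> 0" "X\<^sup>2 / A - Y\<^sup>2 / C = Z\<^sup>2"
       "L = {(x, y). X * x / A - Y * y / C = Z}" by blast
    show "?affine \<or> ?asymptote"
    proof (cases "Z = 0")
      case False
      have "(X / Z, Y / Z) \<in> hyperbola A C"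
        using *(2) False assms by (simp add: hyperbola_def field_simps)
      moreover have "L = {(x, y). (X / Z) * x / A - (Y / Z) * y / C = 1}"
        using *(3) False assms by (auto simp: field_simps)
      ultimately show ?thesis by blast
    next
      case True
      have "Y\<^sup>2 = (r * X)\<^sup>2"
        using *(2) True assms r by (simp add: field_simps power_mult_distrib)
      then have Y: "Y = r * X \<or> Y = - (r * X)" by (simp add: power2_eq_iff)
      then have X: "X \<noteq> 0" using *(1) True by (auto simp: zero_prod_def)
      have eq: "X * x / A - Y * y / C = X * (r\<^sup>2 * x - Y / X * y) / C" for x y
        using assms r(1) X by (simp add: r(2) field_simps power2_eq_square)
      from Y have "L = {(x, y). y = r * x} \<or> L = {(x, y). y = - r * x}"
      proof
        assume "Y = r * X"
        then have "X * x / A - Y * y / C = X * r * (r * x - y) / C" for x y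
          using eq[of x y] X by (simp add: algebra_simps power2_eq_square)
        then show ?thesis using *(3) True X r(1) assms by auto
      next
        assume "Y = - (r * X)"
        then have "X * x / A - Y * y / C = X * r * (r * x + y) / C" for x y
          using eq[of x y] X by (simp add: algebra_simps power2_eq_square)
        then show ?thesis using *(3) True X r(1) assms by auto
      qed
      then show ?thesis by (simp add: r_def)
    qed
  next
    assume "?affine \<or> ?asymptote"
    then consider (aff) ?affine | (pos) "L = {(x, y). y = r * x}" | (neg) "L = {(x, y). y = - r * x}"
      by (auto simp: r_def)
    then show ?hom
    proof cases
      case aff
      then obtain x\<^sub>0 y\<^sub>0 where "(x\<^sub>0, y\<^sub>0) \<in> hyperbola A C"
        "L = {(x, y). x\<^sub>0 * x / A - y\<^sub>0 * y / C = 1}" by blast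
      then show ?thesis
        by (intro exI[of _ x\<^sub>0] exI[of _ y\<^sub>0] exI[of _ 1])
          (auto simp: hyperbola_def zero_prod_def)
    next
      case pos
      have "1 * x / A - r * y / C = (r * x - y) / (r * A)" for x y
        using assms r(1) by (simp add: r(2) field_simps power2_eq_square)
      then show ?thesis using pos assms r(1)
        by (intro exI[of _ 1] exI[of _ r] exI[of _ 0]) (auto simp: r(2) zero_prod_def)
    next
      case neg
      have "1 * x / A - (- r) * y / C = (r * x + y) / (r * A)" for x y
        using assms r(1) by (simp add: r(2) field_simps power2_eq_square)
      then show ?thesis using neg assms r(1)
        by (intro exI[of _ 1] exI[of _ "- r"] exI[of _ 0]) (auto simp: r(2) zero_prod_def)
    qed
  qed
  with 1 show ?thesis by simp
qed

end

theory Submission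
  imports Defs
begin

text \<open>
  Put \<open>u = \<delta> n\<^sub>1 + c\<^sub>1\<close> and \<open>v = \<delta> n\<^sub>2 + c\<^sub>2\<close>.  The normalisation of the four amplitudes is such that,
  measured in the semi-axes of the hyperbola, the lattice point has the coordinates
  \<open>x / sqrt a\<^sub>0 = sn u / sn v\<close> and \<open>y / sqrt c\<^sub>0 = dn u cn v / (k' sn v)\<close> with \<open>k' = sqrt (1 - k\<^sup>2)\<close>.
  So \<open>\<delta>\<close> enters only through the semi-axes of the hyperbola and through the fact that \<open>n\<^sub>1 + n\<^sub>2\<close>
  (respectively \<open>n\<^sub>2 - n\<^sub>1\<close>) determines \<open>w = u + v\<close> (respectively \<open>w = v - u\<close>).

  In these coordinates the tangents of the hyperbola are the lines \<open>X x - Y y = Z\<close> with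
  \<open>X\<^sup>2 - Y\<^sup>2 = Z\<^sup>2\<close>, and \<open>dn\<^sup>2 w - k'\<^sup>2 sn\<^sup>2 w = cn\<^sup>2 w\<close> is exactly of this form.  That the points lie
  on the lines with \<open>(X, Y, Z) = (dn w, k' sn w, - cn w)\<close>, respectively
  \<open>(dn w, - k' sn w, cn w)\<close>, is the content of the three-term relations
  \<open>sn (u + v) dn u cn v = dn (u + v) sn u + cn (u + v) sn v\<close> and
  \<open>cn w sn (u + w) - sn w dn u cn (u + w) = dn w sn u\<close>
  (\<open>jacobi_three_term_sum\<close> and \<open>jacobi_three_term_diff\<close>).

  Both relations follow from the addition theorems.  These are obtained from the derivatives of
  \<open>sn\<close>, \<open>cn\<close> and \<open>dn\<close>: along \<open>u + v = const\<close> the right-hand side of each addition formula has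
  derivative zero, and for \<open>u = 0\<close> it is the left-hand side.

  A tangent may touch the hyperbola at infinity: for \<open>cn w = 0\<close> the line is an asymptote.
\<close>

section \<open>Derivatives of the Jacobi functions\<close>

lemma jacobi_am_ell_F:
  assumes "0 < k" "k < 1"
  shows "jacobi_am (ell_F \<phi> k) k = \<phi>"
  using ell_F_ex1[OF assms] ell_F_jacobi_am[OF assms] by blast

lemma jacobi_am_has_real_derivative:
  assumes k: "0 < k" "k < 1"
  shows "((\<lambda>u. jacobi_am u k) has_real_derivative jacobi_dn u k) (at u)"
proof -
  let ?\<phi> = "jacobi_am u k"
  have contF: "isCont (\<lambda>\<phi>. ell_F \<phi> k) \<phi>" for \<phi>
    using ell_F_has_real_derivative[OF k] DERIV_isCont by blast
  have "isCont (\<lambda>u. jacobi_am u k) (ell_F ?\<phi> k)"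
    by (rule isCont_inverse_function[where d = 1]) (simp_all add: jacobi_am_ell_F k contF)
  then have cont: "isCont (\<lambda>u. jacobi_am u k) u"
    by (simp add: ell_F_jacobi_am k)
  have "((\<lambda>u. jacobi_am u k) has_real_derivative
          inverse (1 / sqrt (1 - k\<^sup>2 * (sin ?\<phi>)\<^sup>2))) (at u)"
    by (rule DERIV_inverse_function[where f = "\<lambda>\<phi>. ell_F \<phi> k" and a = "u - 1" and b = "u + 1"])
      (use modulus_bound(1)[OF k, of ?\<phi>] cont in
        \<open>simp_all add: ell_F_jacobi_am ell_F_has_real_derivative k\<close>)
  then show ?thesis
    by (simp add: jacobi_dn_def jacobi_sn_def)
qed

lemma jacobi_dn_pos:
  assumes "0 < k" "k < 1"
  shows "0 < jacobi_dn u k"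
  using modulus_bound(1)[OF assms] by (simp add: jacobi_dn_def jacobi_sn_def)

lemma jacobi_cn_squared: "(jacobi_cn u k)\<^sup>2 = 1 - (jacobi_sn u k)\<^sup>2"
  by (simp add: jacobi_sn_def jacobi_cn_def cos_squared_eq)

lemma jacobi_dn_squared:
  assumes "0 < k" "k < 1"
  shows "(jacobi_dn u k)\<^sup>2 = 1 - k\<^sup>2 * (jacobi_sn u k)\<^sup>2"
  using modulus_bound(1)[OF assms, of "jacobi_am u k"]
  by (simp add: jacobi_dn_def jacobi_sn_def)

lemma jacobi_at_0:
  assumes "0 < k" "k < 1"
  shows "jacobi_sn 0 k = 0" "jacobi_cn 0 k = 1" "jacobi_dn 0 k = 1"
  using jacobi_am_ell_F[OF assms, of 0]
  by (simp_all add: ell_F_0 jacobi_sn_def jacobi_cn_def jacobi_dn_def)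

lemma jacobi_sn_has_real_derivative:
  assumes "0 < k" "k < 1"
  shows "((\<lambda>u. jacobi_sn u k) has_real_derivative jacobi_cn u k * jacobi_dn u k) (at u)"
  unfolding jacobi_sn_def jacobi_cn_def
  by (rule derivative_eq_intros jacobi_am_has_real_derivative[OF assms] refl | simp)+

lemma jacobi_cn_has_real_derivative:
  assumes "0 < k" "k < 1"
  shows "((\<lambda>u. jacobi_cn u k) has_real_derivative - (jacobi_sn u k * jacobi_dn u k)) (at u)"
  unfolding jacobi_sn_def jacobi_cn_def
  by (rule derivative_eq_intros jacobi_am_has_real_derivative[OF assms] refl | simp)+

lemma jacobi_dn_has_real_derivative:
  assumes k: "0 < k" "k < 1"
  shows "((\<lambda>u. jacobi_dn u k) has_real_derivative - (k\<^sup>2 * jacobi_sn u k * jacobi_cn u k)) (at u)"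
proof -
  have pos: "0 < 1 - k\<^sup>2 * (jacobi_sn u k)\<^sup>2"
    using modulus_bound(1)[OF k] by (simp add: jacobi_sn_def)
  have "((\<lambda>u. sqrt (1 - k\<^sup>2 * (jacobi_sn u k)\<^sup>2)) has_real_derivative
      - (k\<^sup>2 * (2 * jacobi_sn u k * (jacobi_cn u k * jacobi_dn u k)))
        / (2 * sqrt (1 - k\<^sup>2 * (jacobi_sn u k)\<^sup>2))) (at u)"
    using pos by (auto intro!: derivative_eq_intros jacobi_sn_has_real_derivative[OF k]
        simp: field_simps)
  moreover have "sqrt (1 - k\<^sup>2 * (jacobi_sn u k)\<^sup>2) = jacobi_dn u k"
    by (simp add: jacobi_dn_def)
  ultimately show ?thesis
    using jacobi_dn_pos[OF k, of u] unfolding jacobi_dn_def[abs_def] by (simp add: field_simps)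
qed

section \<open>Addition theorems\<close>

lemma jacobi_addition_denominator_pos:
  assumes k: "0 < k" "k < 1"
  shows "0 < 1 - k\<^sup>2 * (jacobi_sn u k)\<^sup>2 * (jacobi_sn v k)\<^sup>2"
proof -
  have "(jacobi_sn v k)\<^sup>2 \<le> 1" for v
    by (simp add: jacobi_sn_def abs_square_le_1)
  then have "k\<^sup>2 * (jacobi_sn u k)\<^sup>2 * (jacobi_sn v k)\<^sup>2 \<le> k\<^sup>2 * (jacobi_sn u k)\<^sup>2 * 1"
    by (intro mult_left_mono) auto
  with modulus_bound(1)[OF k, of "jacobi_am u k"] show ?thesis
    by (simp add: jacobi_sn_def)
qed

text \<open>
  The three addition theorems have the same denominator \<open>E = 1 - k\<^sup>2 sn\<^sup>2 u sn\<^sup>2 v\<close>, and are proved by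
  the same principle: for \<open>u = t\<close> and \<open>v = w - t\<close> with \<open>w\<close> fixed, a quotient \<open>N / E\<close> with \<open>N' E = N E'\<close> is
  constant in \<open>t\<close>, so its value can be read off at \<open>t = 0\<close>, where \<open>E = 1\<close>.
\<close>

lemma jacobi_addition_principle:
  fixes N N' :: "real \<Rightarrow> real"
  assumes k: "0 < k" "k < 1"
    and N: "\<And>t. (N has_real_derivative N' t) (at t)"
    and eq: "\<And>t. N' t * (1 - k\<^sup>2 * (jacobi_sn t k)\<^sup>2 * (jacobi_sn (w - t) k)\<^sup>2) =
      N t * (2 * k\<^sup>2 * jacobi_sn t k * jacobi_sn (w - t) k *
        (jacobi_sn t k * (jacobi_cn (w - t) k * jacobi_dn (w - t) k) -
         jacobi_sn (w - t) k * (jacobi_cn t k * jacobi_dn t k)))"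
  shows "N 0 = N u / (1 - k\<^sup>2 * (jacobi_sn u k)\<^sup>2 * (jacobi_sn (w - u) k)\<^sup>2)"
proof -
  define E where "E t = 1 - k\<^sup>2 * (jacobi_sn t k)\<^sup>2 * (jacobi_sn (w - t) k)\<^sup>2" for t
  have E: "(E has_real_derivative 2 * k\<^sup>2 * jacobi_sn t k * jacobi_sn (w - t) k *
        (jacobi_sn t k * (jacobi_cn (w - t) k * jacobi_dn (w - t) k) -
         jacobi_sn (w - t) k * (jacobi_cn t k * jacobi_dn t k))) (at t)" for t
    unfolding E_def[abs_def]
    by (rule derivative_eq_intros jacobi_sn_has_real_derivative[OF k]
        DERIV_chain'[OF _ jacobi_sn_has_real_derivative[OF k]] refl
        | simp add: algebra_simps power2_eq_square)+
  have nz: "E t \<noteq> 0" for t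
    using jacobi_addition_denominator_pos[OF k, of t "w - t"] by (simp add: E_def)
  have "((\<lambda>t. N t / E t) has_real_derivative 0) (at t)" for t
    using DERIV_divide[OF N E nz, of t] eq[of t, folded E_def] by simp
  then have "N 0 / E 0 = N u / E u"
    using DERIV_isconst_all[of "\<lambda>t. N t / E t"] by blast
  then show ?thesis by (simp add: E_def jacobi_at_0[OF k])
qed

lemma jacobi_sn_add:
  assumes k: "0 < k" "k < 1"
  shows "jacobi_sn (u + v) k =
    (jacobi_sn u k * jacobi_cn v k * jacobi_dn v k + jacobi_sn v k * jacobi_cn u k * jacobi_dn u k)
    / (1 - k\<^sup>2 * (jacobi_sn u k)\<^sup>2 * (jacobi_sn v k)\<^sup>2)"
proof -
  define w where "w = u + v"
  define N where "N t = jacobi_sn t k * jacobi_cn (w - t) k * jacobi_dn (w - t) k + jacobi_sn (w - t) k * jacobi_cn t k * jacobi_dn t k" for t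
  have "N 0 = N u / (1 - k\<^sup>2 * (jacobi_sn u k)\<^sup>2 * (jacobi_sn (w - u) k)\<^sup>2)"
  proof (rule jacobi_addition_principle[OF k])
    show "(N has_real_derivative
        jacobi_sn t k * jacobi_sn (w - t) k *
          ((jacobi_dn (w - t) k)\<^sup>2 + k\<^sup>2 * (jacobi_cn (w - t) k)\<^sup>2 -
           (jacobi_dn t k)\<^sup>2 - k\<^sup>2 * (jacobi_cn t k)\<^sup>2)) (at t)" for t
      unfolding N_def[abs_def]
      by (rule derivative_eq_intros jacobi_sn_has_real_derivative[OF k]
          jacobi_cn_has_real_derivative[OF k] jacobi_dn_has_real_derivative[OF k]
          DERIV_chain'[OF _ jacobi_sn_has_real_derivative[OF k]]
          DERIV_chain'[OF _ jacobi_cn_has_real_derivative[OF k]]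
          DERIV_chain'[OF _ jacobi_dn_has_real_derivative[OF k]] refl
          | simp add: algebra_simps power2_eq_square)+
  next
    fix t
    show "(jacobi_sn t k * jacobi_sn (w - t) k *
          ((jacobi_dn (w - t) k)\<^sup>2 + k\<^sup>2 * (jacobi_cn (w - t) k)\<^sup>2 -
           (jacobi_dn t k)\<^sup>2 - k\<^sup>2 * (jacobi_cn t k)\<^sup>2)) *
        (1 - k\<^sup>2 * (jacobi_sn t k)\<^sup>2 * (jacobi_sn (w - t) k)\<^sup>2) =
      N t * (2 * k\<^sup>2 * jacobi_sn t k * jacobi_sn (w - t) k *
        (jacobi_sn t k * (jacobi_cn (w - t) k * jacobi_dn (w - t) k) -
         jacobi_sn (w - t) k * (jacobi_cn t k * jacobi_dn t k)))"
      unfolding N_def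
      using jacobi_cn_squared[of t k] jacobi_dn_squared[OF k, of t]
        jacobi_cn_squared[of "w - t" k] jacobi_dn_squared[OF k, of "w - t"]
      by algebra
  qed
  then show ?thesis by (simp add: N_def w_def jacobi_at_0[OF k])
qed

lemma jacobi_cn_add:
  assumes k: "0 < k" "k < 1"
  shows "jacobi_cn (u + v) k =
    (jacobi_cn u k * jacobi_cn v k -
      jacobi_sn u k * jacobi_sn v k * jacobi_dn u k * jacobi_dn v k)
    / (1 - k\<^sup>2 * (jacobi_sn u k)\<^sup>2 * (jacobi_sn v k)\<^sup>2)"
proof -
  define w where "w = u + v"
  define N where "N t = jacobi_cn t k * jacobi_cn (w - t) k -
      jacobi_sn t k * jacobi_sn (w - t) k * jacobi_dn t k * jacobi_dn (w - t) k" for t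
  have "N 0 = N u / (1 - k\<^sup>2 * (jacobi_sn u k)\<^sup>2 * (jacobi_sn (w - u) k)\<^sup>2)"
  proof (rule jacobi_addition_principle[OF k])
    show "(N has_real_derivative
        jacobi_sn t k * jacobi_dn t k * jacobi_cn (w - t) k * ((jacobi_dn (w - t) k)\<^sup>2 - 1 - k\<^sup>2 * (jacobi_sn (w - t) k)\<^sup>2) -
        jacobi_sn (w - t) k * jacobi_dn (w - t) k * jacobi_cn t k * ((jacobi_dn t k)\<^sup>2 - 1 - k\<^sup>2 * (jacobi_sn t k)\<^sup>2)) (at t)" for t
      unfolding N_def[abs_def]
      by (rule derivative_eq_intros jacobi_sn_has_real_derivative[OF k]
          jacobi_cn_has_real_derivative[OF k] jacobi_dn_has_real_derivative[OF k]
          DERIV_chain'[OF _ jacobi_sn_has_real_derivative[OF k]]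
          DERIV_chain'[OF _ jacobi_cn_has_real_derivative[OF k]]
          DERIV_chain'[OF _ jacobi_dn_has_real_derivative[OF k]] refl
          | simp add: algebra_simps power2_eq_square)+
  next
    fix t
    show "(jacobi_sn t k * jacobi_dn t k * jacobi_cn (w - t) k * ((jacobi_dn (w - t) k)\<^sup>2 - 1 - k\<^sup>2 * (jacobi_sn (w - t) k)\<^sup>2) -
        jacobi_sn (w - t) k * jacobi_dn (w - t) k * jacobi_cn t k * ((jacobi_dn t k)\<^sup>2 - 1 - k\<^sup>2 * (jacobi_sn t k)\<^sup>2)) *
        (1 - k\<^sup>2 * (jacobi_sn t k)\<^sup>2 * (jacobi_sn (w - t) k)\<^sup>2) =
      N t * (2 * k\<^sup>2 * jacobi_sn t k * jacobi_sn (w - t) k *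
        (jacobi_sn t k * (jacobi_cn (w - t) k * jacobi_dn (w - t) k) -
         jacobi_sn (w - t) k * (jacobi_cn t k * jacobi_dn t k)))"
      unfolding N_def
      using jacobi_cn_squared[of t k] jacobi_dn_squared[OF k, of t]
        jacobi_cn_squared[of "w - t" k] jacobi_dn_squared[OF k, of "w - t"]
      by algebra
  qed
  then show ?thesis by (simp add: N_def w_def jacobi_at_0[OF k])
qed

lemma jacobi_dn_add:
  assumes k: "0 < k" "k < 1"
  shows "jacobi_dn (u + v) k =
    (jacobi_dn u k * jacobi_dn v k -
      k\<^sup>2 * jacobi_sn u k * jacobi_sn v k * jacobi_cn u k * jacobi_cn v k)
    / (1 - k\<^sup>2 * (jacobi_sn u k)\<^sup>2 * (jacobi_sn v k)\<^sup>2)"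
proof -
  define w where "w = u + v"
  define N where "N t = jacobi_dn t k * jacobi_dn (w - t) k -
      k\<^sup>2 * jacobi_sn t k * jacobi_sn (w - t) k * jacobi_cn t k * jacobi_cn (w - t) k" for t
  have "N 0 = N u / (1 - k\<^sup>2 * (jacobi_sn u k)\<^sup>2 * (jacobi_sn (w - u) k)\<^sup>2)"
  proof (rule jacobi_addition_principle[OF k])
    show "(N has_real_derivative
        k\<^sup>2 * (jacobi_sn t k * jacobi_cn t k * jacobi_dn (w - t) k * ((jacobi_cn (w - t) k)\<^sup>2 - 1 - (jacobi_sn (w - t) k)\<^sup>2) -
          jacobi_sn (w - t) k * jacobi_cn (w - t) k * jacobi_dn t k * ((jacobi_cn t k)\<^sup>2 - 1 - (jacobi_sn t k)\<^sup>2))) (at t)" for t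
      unfolding N_def[abs_def]
      by (rule derivative_eq_intros jacobi_sn_has_real_derivative[OF k]
          jacobi_cn_has_real_derivative[OF k] jacobi_dn_has_real_derivative[OF k]
          DERIV_chain'[OF _ jacobi_sn_has_real_derivative[OF k]]
          DERIV_chain'[OF _ jacobi_cn_has_real_derivative[OF k]]
          DERIV_chain'[OF _ jacobi_dn_has_real_derivative[OF k]] refl
          | simp add: algebra_simps power2_eq_square)+
  next
    fix t
    show "(k\<^sup>2 * (jacobi_sn t k * jacobi_cn t k * jacobi_dn (w - t) k * ((jacobi_cn (w - t) k)\<^sup>2 - 1 - (jacobi_sn (w - t) k)\<^sup>2) -
          jacobi_sn (w - t) k * jacobi_cn (w - t) k * jacobi_dn t k * ((jacobi_cn t k)\<^sup>2 - 1 - (jacobi_sn t k)\<^sup>2))) *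
        (1 - k\<^sup>2 * (jacobi_sn t k)\<^sup>2 * (jacobi_sn (w - t) k)\<^sup>2) =
      N t * (2 * k\<^sup>2 * jacobi_sn t k * jacobi_sn (w - t) k *
        (jacobi_sn t k * (jacobi_cn (w - t) k * jacobi_dn (w - t) k) -
         jacobi_sn (w - t) k * (jacobi_cn t k * jacobi_dn t k)))"
      unfolding N_def
      using jacobi_cn_squared[of t k] jacobi_dn_squared[OF k, of t]
        jacobi_cn_squared[of "w - t" k] jacobi_dn_squared[OF k, of "w - t"]
      by algebra
  qed
  then show ?thesis by (simp add: N_def w_def jacobi_at_0[OF k])
qed

section \<open>Collinearity and tangency\<close>

text \<open>
  After multiplication by the common denominator of the addition theorems, both sides become
  \<open>sn u dn u dn v cn\<^sup>2 v + sn v cn u cn v dn\<^sup>2 u\<close>.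
\<close>

lemma jacobi_three_term_sum:
  assumes k: "0 < k" "k < 1"
  shows "jacobi_sn (u + v) k * jacobi_dn u k * jacobi_cn v k =
    jacobi_dn (u + v) k * jacobi_sn u k + jacobi_cn (u + v) k * jacobi_sn v k"
proof -
  define E where "E = 1 - k\<^sup>2 * (jacobi_sn u k)\<^sup>2 * (jacobi_sn v k)\<^sup>2"
  have E: "E \<noteq> 0" using jacobi_addition_denominator_pos[OF k, of u v] by (simp add: E_def)
  have "jacobi_sn (u + v) k * E =
      jacobi_sn u k * jacobi_cn v k * jacobi_dn v k + jacobi_sn v k * jacobi_cn u k * jacobi_dn u k"
    and "jacobi_cn (u + v) k * E =
      jacobi_cn u k * jacobi_cn v k - jacobi_sn u k * jacobi_sn v k * jacobi_dn u k * jacobi_dn v k"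
    and "jacobi_dn (u + v) k * E =
      jacobi_dn u k * jacobi_dn v k -
      k\<^sup>2 * jacobi_sn u k * jacobi_sn v k * jacobi_cn u k * jacobi_cn v k"
    using E by (simp_all add: jacobi_sn_add jacobi_cn_add jacobi_dn_add k E_def)
  then have "jacobi_sn (u + v) k * jacobi_dn u k * jacobi_cn v k * E =
    (jacobi_dn (u + v) k * jacobi_sn u k + jacobi_cn (u + v) k * jacobi_sn v k) * E"
    using jacobi_cn_squared[of u k] jacobi_dn_squared[OF k, of u]
      jacobi_cn_squared[of v k] jacobi_dn_squared[OF k, of v]
    by algebra
  with E show ?thesis by simp
qed

text \<open>
  After multiplication by the common denominator, the left-hand side becomes
  \<open>sn u dn w (cn\<^sup>2 w + sn\<^sup>2 w dn\<^sup>2 u)\<close>, and the bracket is that denominator.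
\<close>

lemma jacobi_three_term_diff:
  assumes k: "0 < k" "k < 1"
  shows "jacobi_cn w k * jacobi_sn (u + w) k - jacobi_sn w k * jacobi_dn u k * jacobi_cn (u + w) k =
    jacobi_dn w k * jacobi_sn u k"
proof -
  define E where "E = 1 - k\<^sup>2 * (jacobi_sn u k)\<^sup>2 * (jacobi_sn w k)\<^sup>2"
  have E: "E \<noteq> 0" using jacobi_addition_denominator_pos[OF k, of u w] by (simp add: E_def)
  have "jacobi_sn (u + w) k * E =
      jacobi_sn u k * jacobi_cn w k * jacobi_dn w k + jacobi_sn w k * jacobi_cn u k * jacobi_dn u k"
    and "jacobi_cn (u + w) k * E =
      jacobi_cn u k * jacobi_cn w k - jacobi_sn u k * jacobi_sn w k * jacobi_dn u k * jacobi_dn w k"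
    using E by (simp_all add: jacobi_sn_add jacobi_cn_add k E_def)
  then have "(jacobi_cn w k * jacobi_sn (u + w) k -
      jacobi_sn w k * jacobi_dn u k * jacobi_cn (u + w) k) * E =
    jacobi_dn w k * jacobi_sn u k * E"
    using jacobi_cn_squared[of u k] jacobi_dn_squared[OF k, of u]
      jacobi_cn_squared[of w k] jacobi_dn_squared[OF k, of w] E_def
    by algebra
  with E show ?thesis by simp
qed

lemma straight_line_equation:
  assumes "(p, q) \<noteq> (0, 0)"
  shows "straight_line {(x, y). p * x + q * y = r}"
proof -
  have "{(x, y). p * x + q * y = r} = {z. (p, q) \<bullet> z = r}"
    by auto
  then show ?thesis
    using assms affine_hyperplane[of "(p, q)" r] aff_dim_hyperplane[of "(p, q)" r]
    by (simp add: straight_line_def zero_prod_def)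
qed

text \<open>
  The line \<open>X x - Y y = Z\<close>, in coordinates scaled by the semi-axes, touches the hyperbola at the
  point with scaled homogeneous coordinates \<open>(X, Y, Z)\<close>; for \<open>Z = 0\<close> this point is at infinity.
\<close>

lemma tangent_line_in_scaled_coordinates:
  assumes A: "0 < A" and C: "0 < C" and X: "X \<noteq> 0" and Z: "X\<^sup>2 - Y\<^sup>2 = Z\<^sup>2"
  defines "L \<equiv> {(x, y). X * (x / sqrt A) - Y * (y / sqrt C) = Z}"
  shows "straight_line L" "tangent_to_hyperbola A C L"
proof -
  have "L = {(x, y). X / sqrt A * x + (- Y / sqrt C) * y = Z}"
    by (auto simp: L_def)
  moreover have "(X / sqrt A, - Y / sqrt C) \<noteq> (0, 0)"
    using A X by simp
  ultimately show "straight_line L"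
    using straight_line_equation by metis
  have "sqrt A * X * x / A - sqrt C * Y * y / C = X * (x / sqrt A) - Y * (y / sqrt C)" for x y
    using A C by (simp add: real_div_sqrt field_simps)
  then have L: "L = {(x, y). 2 * (sqrt A * X * x / A - sqrt C * Y * y / C - Z * 1) = 0}"
    by (auto simp: L_def)
  show "tangent_to_hyperbola A C L"
    unfolding tangent_to_hyperbola_def
  proof (intro exI conjI)
    show "(sqrt A * X, sqrt C * Y, Z) \<noteq> 0"
      using A X by (simp add: zero_prod_def)
    show "hyperbola_form A C (sqrt A * X, sqrt C * Y, Z) = 0"
      using A C Z by (simp add: hyperbola_form_def power_mult_distrib)
    show "(hyperbola_form A C has_derivative
        (\<lambda>(x, y, z). 2 * (sqrt A * X * x / A - sqrt C * Y * y / C - Z * z)))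
        (at (sqrt A * X, sqrt C * Y, Z))"
      by (rule hyperbola_form_has_derivative)
    show "L = {(x, y). (\<lambda>(x, y, z). 2 * (sqrt A * X * x / A - sqrt C * Y * y / C - Z * z)) (x, y, 1) = 0}"
      using L by simp
  qed
qed

lemma hyperbola_in_confocal_family:
  assumes "A \<noteq> 0" "C \<noteq> 0" "A + C = a - b"
  shows "hyperbola A C \<in> confocal_family a b"
proof -
  have "a + (A - a) = A" "b + (A - a) = - C" using assms(3) by simp_all
  then show ?thesis
    using assms(1,2) by (auto simp: confocal_family_def hyperbola_def intro!: exI[of _ "A - a"])
qed

theorem proposition8p4:
  fixes a b k \<delta> c\<^sub>1 c\<^sub>2 :: real
    and \<alpha>\<^sub>1 \<alpha>\<^sub>2 \<beta>\<^sub>1 \<beta>\<^sub>2 a\<^sub>0 c\<^sub>0 :: real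
    and f\<^sub>1 g\<^sub>1 f\<^sub>2 g\<^sub>2 :: "real \<Rightarrow> real"
    and x y :: "real \<Rightarrow> real \<Rightarrow> real"
  assumes "a > b" and "0 < k" and "k < 1" and "jacobi_cn (\<delta> / 2) k > 0"
    and "(1 / k) * \<alpha>\<^sub>1 = sqrt ((a - b) * (jacobi_cn (\<delta> / 2) k / jacobi_dn (\<delta> / 2) k))"
    and "\<alpha>\<^sub>2 = sqrt ((a - b) * (jacobi_cn (\<delta> / 2) k / jacobi_dn (\<delta> / 2) k))"
    and "\<beta>\<^sub>1 = sqrt ((a - b) / jacobi_dn (\<delta> / 2) k)"
    and "\<beta>\<^sub>2 = sqrt ((a - b) / jacobi_dn (\<delta> / 2) k)"
    and "\<And>n\<^sub>1. f\<^sub>1 n\<^sub>1 = \<alpha>\<^sub>1 * jacobi_sn (\<delta> * n\<^sub>1 + c\<^sub>1) k"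
    and "\<And>n\<^sub>1. g\<^sub>1 n\<^sub>1 = \<beta>\<^sub>1 * jacobi_dn (\<delta> * n\<^sub>1 + c\<^sub>1) k"
    and "\<And>n\<^sub>2. f\<^sub>2 n\<^sub>2 = \<alpha>\<^sub>2 * (1 / jacobi_sn (\<delta> * n\<^sub>2 + c\<^sub>2) k)"
    and "\<And>n\<^sub>2. g\<^sub>2 n\<^sub>2 = \<beta>\<^sub>2 * (jacobi_cn (\<delta> * n\<^sub>2 + c\<^sub>2) k / jacobi_sn (\<delta> * n\<^sub>2 + c\<^sub>2) k)"
    and "\<And>n\<^sub>1 n\<^sub>2. x n\<^sub>1 n\<^sub>2 = f\<^sub>1 n\<^sub>1 * f\<^sub>2 n\<^sub>2 / sqrt (a - b)"
    and "\<And>n\<^sub>1 n\<^sub>2. y n\<^sub>1 n\<^sub>2 = g\<^sub>1 n\<^sub>1 * g\<^sub>2 n\<^sub>2 / sqrt (a - b)"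
    and "a\<^sub>0 = (a - b) * k\<^sup>2 * ((jacobi_cn (\<delta> / 2) k)\<^sup>2 / (jacobi_dn (\<delta> / 2) k)\<^sup>2)"
    and "c\<^sub>0 = (a - b) * (1 - k\<^sup>2) * (1 / (jacobi_dn (\<delta> / 2) k)\<^sup>2)"
  shows "(\<forall>\<xi>\<in>half_ints. \<exists>L. straight_line L \<and>
            {(x n\<^sub>1 n\<^sub>2, y n\<^sub>1 n\<^sub>2) | n\<^sub>1 n\<^sub>2. n\<^sub>1 \<in> half_ints \<and> n\<^sub>2 \<in> half_ints \<and>
               jacobi_sn (\<delta> * n\<^sub>2 + c\<^sub>2) k \<noteq> 0 \<and> n\<^sub>1 + n\<^sub>2 = \<xi>} \<subseteq> L \<and>
            tangent_to_hyperbola a\<^sub>0 c\<^sub>0 L)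
       \<and> (\<forall>\<eta>\<in>half_ints. \<exists>L. straight_line L \<and>
            {(x n\<^sub>1 n\<^sub>2, y n\<^sub>1 n\<^sub>2) | n\<^sub>1 n\<^sub>2. n\<^sub>1 \<in> half_ints \<and> n\<^sub>2 \<in> half_ints \<and>
               jacobi_sn (\<delta> * n\<^sub>2 + c\<^sub>2) k \<noteq> 0 \<and> n\<^sub>2 - n\<^sub>1 = \<eta>} \<subseteq> L \<and>
            tangent_to_hyperbola a\<^sub>0 c\<^sub>0 L)
       \<and> 0 < a\<^sub>0 \<and> 0 < c\<^sub>0 \<and> a\<^sub>0 + c\<^sub>0 = a - b
       \<and> hyperbola a\<^sub>0 c\<^sub>0 \<in> confocal_family a b"
proof -
  note k = assms(2,3)
  define D where "D = a - b"
  define C where "C = jacobi_cn (\<delta> / 2) k"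
  define d where "d = jacobi_dn (\<delta> / 2) k"
  define k' where "k' = sqrt (1 - k\<^sup>2)"
  have D: "0 < D" using assms(1) by (simp add: D_def)
  have C: "0 < C" using assms(4) by (simp add: C_def)
  have d: "0 < d" using jacobi_dn_pos[OF k] by (simp add: d_def)
  have k1: "k\<^sup>2 < 1" using k by (simp add: power_less_one_iff)
  have k': "0 < k'" "k'\<^sup>2 = 1 - k\<^sup>2" using k1 by (simp_all add: k'_def)
  have d2: "d\<^sup>2 = k\<^sup>2 * C\<^sup>2 + (1 - k\<^sup>2)"
    using jacobi_cn_squared[of "\<delta> / 2" k] jacobi_dn_squared[OF k, of "\<delta> / 2"]
    unfolding C_def d_def by algebra
  have a0: "a\<^sub>0 = D * k\<^sup>2 * (C\<^sup>2 / d\<^sup>2)" and c0: "c\<^sub>0 = D * (1 - k\<^sup>2) * (1 / d\<^sup>2)"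
    using assms(15,16) by (simp_all add: D_def C_def d_def)
  have pos: "0 < a\<^sub>0" "0 < c\<^sub>0"
    using D C d k k1 by (simp_all add: a0 c0)
  have "a\<^sub>0 + c\<^sub>0 = D * (k\<^sup>2 * C\<^sup>2 + (1 - k\<^sup>2)) / d\<^sup>2"
    using d by (simp add: a0 c0 field_simps)
  then have sum: "a\<^sub>0 + c\<^sub>0 = a - b"
    using d by (simp add: d2[symmetric] D_def)
  have sqrt_a0: "sqrt a\<^sub>0 = sqrt D * (k * C / d)"
    using k C d by (simp add: a0 real_sqrt_mult real_sqrt_divide)
  have sqrt_c0: "sqrt c\<^sub>0 = sqrt D * (k' / d)"
    using d by (simp add: c0 real_sqrt_mult real_sqrt_divide k'_def)

  \<comment> \<open>Apart from \<open>sqrt D\<close> and \<open>k'\<close>, the products of amplitudes are the semi-axes of the hyperbola,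
    so that scaling by these leaves quotients of Jacobi functions without \<open>\<delta> / 2\<close>.\<close>
  have "\<alpha>\<^sub>1 * \<alpha>\<^sub>2 = k * (sqrt (D * (C / d)))\<^sup>2"
    using assms(5,6) k by (simp add: D_def C_def d_def field_simps power2_eq_square)
  then have \<alpha>: "\<alpha>\<^sub>1 * \<alpha>\<^sub>2 = sqrt D * sqrt a\<^sub>0"
    using D C d by (simp add: sqrt_a0)
  have "\<beta>\<^sub>1 * \<beta>\<^sub>2 = (sqrt (D / d))\<^sup>2"
    using assms(7,8) by (simp add: D_def d_def power2_eq_square)
  then have \<beta>: "\<beta>\<^sub>1 * \<beta>\<^sub>2 = sqrt D * (sqrt c\<^sub>0 / k')"
    using D d k' by (simp add: sqrt_c0)
  have x: "x n\<^sub>1 n\<^sub>2 / sqrt a\<^sub>0 = jacobi_sn (\<delta> * n\<^sub>1 + c\<^sub>1) k / jacobi_sn (\<delta> * n\<^sub>2 + c\<^sub>2) k" for n\<^sub>1 n\<^sub>2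
  proof -
    have "x n\<^sub>1 n\<^sub>2 = (\<alpha>\<^sub>1 * \<alpha>\<^sub>2) / sqrt D *
        (jacobi_sn (\<delta> * n\<^sub>1 + c\<^sub>1) k / jacobi_sn (\<delta> * n\<^sub>2 + c\<^sub>2) k)"
      by (simp add: assms(9,11,13) D_def ac_simps)
    then show ?thesis using D pos by (simp add: \<alpha>)
  qed
  have y: "y n\<^sub>1 n\<^sub>2 / sqrt c\<^sub>0 = jacobi_dn (\<delta> * n\<^sub>1 + c\<^sub>1) k * jacobi_cn (\<delta> * n\<^sub>2 + c\<^sub>2) k
      / (k' * jacobi_sn (\<delta> * n\<^sub>2 + c\<^sub>2) k)" for n\<^sub>1 n\<^sub>2
  proof -
    have "y n\<^sub>1 n\<^sub>2 = (\<beta>\<^sub>1 * \<beta>\<^sub>2) / sqrt D *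
        (jacobi_dn (\<delta> * n\<^sub>1 + c\<^sub>1) k * jacobi_cn (\<delta> * n\<^sub>2 + c\<^sub>2) k / jacobi_sn (\<delta> * n\<^sub>2 + c\<^sub>2) k)"
      by (simp add: assms(10,12,14) D_def ac_simps)
    then show ?thesis using D pos by (simp add: \<beta>)
  qed

  have dn_nz: "jacobi_dn w k \<noteq> 0" for w
    using jacobi_dn_pos[OF k, of w] by simp
  have coeffs: "(jacobi_dn w k)\<^sup>2 - (k' * jacobi_sn w k)\<^sup>2 = (jacobi_cn w k)\<^sup>2" for w
    by (simp add: jacobi_cn_squared jacobi_dn_squared[OF k] power_mult_distrib k'(2) algebra_simps)

  have sum_lines: "\<exists>L. straight_line L \<and>
      {(x n\<^sub>1 n\<^sub>2, y n\<^sub>1 n\<^sub>2) | n\<^sub>1 n\<^sub>2. n\<^sub>1 \<in> half_ints \<and> n\<^sub>2 \<in> half_ints \<and>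
         jacobi_sn (\<delta> * n\<^sub>2 + c\<^sub>2) k \<noteq> 0 \<and> n\<^sub>1 + n\<^sub>2 = \<xi>} \<subseteq> L \<and>
      tangent_to_hyperbola a\<^sub>0 c\<^sub>0 L" for \<xi>
  proof -
    define w where "w = \<delta> * \<xi> + c\<^sub>1 + c\<^sub>2"
    define L where "L = {(x, y). jacobi_dn w k * (x / sqrt a\<^sub>0) -
      (k' * jacobi_sn w k) * (y / sqrt c\<^sub>0) = - jacobi_cn w k}"
    have "straight_line L" "tangent_to_hyperbola a\<^sub>0 c\<^sub>0 L"
      unfolding L_def using tangent_line_in_scaled_coordinates[OF pos dn_nz] coeffs[of w] by auto
    moreover have "(x n\<^sub>1 n\<^sub>2, y n\<^sub>1 n\<^sub>2) \<in> L"
      if nz: "jacobi_sn (\<delta> * n\<^sub>2 + c\<^sub>2) k \<noteq> 0" and n: "n\<^sub>1 + n\<^sub>2 = \<xi>" for n\<^sub>1 n\<^sub>2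
    proof -
      have "(\<delta> * n\<^sub>1 + c\<^sub>1) + (\<delta> * n\<^sub>2 + c\<^sub>2) = w"
        by (simp add: w_def n[symmetric] algebra_simps)
      with jacobi_three_term_sum[OF k, of "\<delta> * n\<^sub>1 + c\<^sub>1" "\<delta> * n\<^sub>2 + c\<^sub>2"]
      have "jacobi_sn w k * jacobi_dn (\<delta> * n\<^sub>1 + c\<^sub>1) k * jacobi_cn (\<delta> * n\<^sub>2 + c\<^sub>2) k =
        jacobi_dn w k * jacobi_sn (\<delta> * n\<^sub>1 + c\<^sub>1) k + jacobi_cn w k * jacobi_sn (\<delta> * n\<^sub>2 + c\<^sub>2) k"
        by simp
      then show ?thesis
        using nz k'(1) unfolding L_def mem_Collect_eq prod.case x y by (simp add: field_simps)
    qed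
    ultimately show ?thesis by blast
  qed

  have diff_lines: "\<exists>L. straight_line L \<and>
      {(x n\<^sub>1 n\<^sub>2, y n\<^sub>1 n\<^sub>2) | n\<^sub>1 n\<^sub>2. n\<^sub>1 \<in> half_ints \<and> n\<^sub>2 \<in> half_ints \<and>
         jacobi_sn (\<delta> * n\<^sub>2 + c\<^sub>2) k \<noteq> 0 \<and> n\<^sub>2 - n\<^sub>1 = \<eta>} \<subseteq> L \<and>
      tangent_to_hyperbola a\<^sub>0 c\<^sub>0 L" for \<eta>
  proof -
    define w where "w = \<delta> * \<eta> + c\<^sub>2 - c\<^sub>1"
    define L where "L = {(x, y). jacobi_dn w k * (x / sqrt a\<^sub>0) -
      (- (k' * jacobi_sn w k)) * (y / sqrt c\<^sub>0) = jacobi_cn w k}"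
    have "(jacobi_dn w k)\<^sup>2 - (- (k' * jacobi_sn w k))\<^sup>2 = (jacobi_cn w k)\<^sup>2"
      using coeffs[of w] by simp
    from tangent_line_in_scaled_coordinates[OF pos dn_nz this]
    have "straight_line L" "tangent_to_hyperbola a\<^sub>0 c\<^sub>0 L"
      unfolding L_def .
    moreover have "(x n\<^sub>1 n\<^sub>2, y n\<^sub>1 n\<^sub>2) \<in> L"
      if nz: "jacobi_sn (\<delta> * n\<^sub>2 + c\<^sub>2) k \<noteq> 0" and n: "n\<^sub>2 - n\<^sub>1 = \<eta>" for n\<^sub>1 n\<^sub>2
    proof -
      have "(\<delta> * n\<^sub>1 + c\<^sub>1) + w = \<delta> * n\<^sub>2 + c\<^sub>2"
        by (simp add: w_def n[symmetric] algebra_simps)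
      with jacobi_three_term_diff[OF k, of w "\<delta> * n\<^sub>1 + c\<^sub>1"]
      have "jacobi_cn w k * jacobi_sn (\<delta> * n\<^sub>2 + c\<^sub>2) k -
          jacobi_sn w k * jacobi_dn (\<delta> * n\<^sub>1 + c\<^sub>1) k * jacobi_cn (\<delta> * n\<^sub>2 + c\<^sub>2) k =
        jacobi_dn w k * jacobi_sn (\<delta> * n\<^sub>1 + c\<^sub>1) k"
        by simp
      then show ?thesis
        using nz k'(1) unfolding L_def mem_Collect_eq prod.case x y by (simp add: field_simps)
    qed
    ultimately show ?thesis by blast
  qed

  show ?thesis
    using sum_lines diff_lines pos sum hyperbola_in_confocal_family[of a\<^sub>0 c\<^sub>0 a b] by simp
qed

end
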